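(* Let $k$ be a field, let $R=k[x,y]$ or $R=k[[x,y]]$, and let $I=\langle x^{a_i}y^{b_i}\rangle_{i=0}^r\subset R$ be an $\langle x,y\rangle$-primary ideal generated by monomials of the same degree $d$, where the nonnegative integer exponents satisfy $a_i<a_{i+1}$ and $b_i>b_{i+1}$ for all $i$; that is, $a_0=b_r=0$ and $b_i=d-a_i$ for all $i$. Let $S=\langle a_i\rangle_{i=0}^r$ and $T=\langle b_i\rangle_{i=0}^r$ be the associated numerical semigroups. Then the Ratliff-Rush reduction number of $I$ satisfies $$r(I)\le\left\lceil\max\left(2\Lambda(S)+2-\frac{g(S)+1}{d},\ 2\Lambda(T)+2-\frac{g(T)+1}{d}\right)\right\rceil-1 .$$
   Context: For nonnegative integers $c_0,\dots,c_r$, the numerical semigroup $\langle c_0,\dots,c_r\rangle$ is the set of all sums $\sum_i\lambda_ic_i$ with $\lambda_i\in\mathbb Z_{\ge 0}$ (the gcd of the generators need not be $1$). Frobenius number: if $S=\langle c_i\rangle$ and $\gcd(c_i)=h$, then $g(S)$ is the greatest integer multiple of $h$ that does not belong to $S$ (possibly negative). For $S=\langle c_i\rangle$ with the given generators and $s\in S$, put $\lambda(s)=\min\{\sum_i\lambda_i : s=\sum_i\lambda_ic_i,\ \lambda_i\in\mathbb Z_{\ge 0}\}$. If $c$ denotes the largest generator, put $\Lambda(S)=\max\{\lambda(s) : s\in S,\ s\le g(S)+c\}$. (For the semigroups $S$ and $T$ in the claim, $c=d$.) For a regular ideal $I$ (one containing a nonzerodivisor) in a Noetherian ring $R$, the Ratliff-Rush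 ideal associated to $I$ is $\tilde I=\bigcup_{l\ge 1}(I^{l+1}:I^l)$ (an increasing union), and the Ratliff-Rush reduction number is $r(I)=\min\{l\in\mathbb Z_{\ge 0} : \tilde I=(I^{l+1}:I^l)\}$. $\lceil c\rceil$ denotes the least integer greater than or equal to $c$. *)

theory Defs
  imports
    "HOL-Algebra.Ideal_Product"
    "HOL-Algebra.Algebraic_Closure_Type"
    "HOL-Computational_Algebra.Polynomial"
    "HOL-Computational_Algebra.Formal_Power_Series"
begin

section \<open>Numerical semigroups with given generators\<close>

text \<open>
  A generating family \<open>c\<^sub>0, \<dots>, c\<^sub>r\<close> is a function \<open>c\<close> on the naturals of which only the
  values at \<open>0, \<dots>, r\<close> matter.
\<close>

definition num_semigroup :: "(nat \<Rightarrow> nat) \<Rightarrow> nat \<Rightarrow> nat set" where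
  "num_semigroup c r = {\<Sum>i\<le>r. l i * c i | l :: nat \<Rightarrow> nat. True}"

text \<open>
  The Frobenius number is an integer because it may be negative: for example it is \<open>-d\<close> for the
  family \<open>0, d\<close>. The greatest element exists whenever some generator is positive.
\<close>

definition frobenius_number :: "(nat \<Rightarrow> nat) \<Rightarrow> nat \<Rightarrow> int" where
  "frobenius_number c r =
     (GREATEST z. int (Gcd (c ` {..r})) dvd z \<and> z \<notin> int ` num_semigroup c r)"

definition gen_length :: "(nat \<Rightarrow> nat) \<Rightarrow> nat \<Rightarrow> nat \<Rightarrow> nat" where
  "gen_length c r s =
     (LEAST n. \<exists>l :: nat \<Rightarrow> nat. n = (\<Sum>i\<le>r. l i) \<and> s = (\<Sum>i\<le>r. l i * c i))"

definition max_gen_length :: "(nat \<Rightarrow> nat) \<Rightarrow> nat \<Rightarrow> nat" where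
  "max_gen_length c r =
     Max (gen_length c r `
       {s \<in> num_semigroup c r. int s \<le> frobenius_number c r + int (Max (c ` {..r}))})"


section \<open>Primary ideals and the Ratliff-Rush reduction number\<close>

definition radical_ideal :: "('a, 'b) ring_scheme \<Rightarrow> 'a set \<Rightarrow> 'a set" where
  "radical_ideal R I = {x \<in> carrier R. \<exists>n :: nat. x [^]\<^bsub>R\<^esub> n \<in> I}"

locale primaryideal = ideal + cring +
  assumes I_notcarr: "carrier R \<noteq> I"
    and I_primary: "\<lbrakk>a \<in> carrier R; b \<in> carrier R; a \<otimes> b \<in> I\<rbrakk>
      \<Longrightarrow> a \<in> I \<or> (\<exists>n :: nat. b [^] n \<in> I)"

definition is_primary_to :: "('a, 'b) ring_scheme \<Rightarrow> 'a set \<Rightarrow> 'a set \<Rightarrow> bool" where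
  "is_primary_to R P I \<longleftrightarrow> primaryideal I R \<and> radical_ideal R I = P"

definition colon_ideal :: "('a, 'b) ring_scheme \<Rightarrow> 'a set \<Rightarrow> 'a set \<Rightarrow> 'a set" where
  "colon_ideal R I J = {x \<in> carrier R. \<forall>y\<in>J. x \<otimes>\<^bsub>R\<^esub> y \<in> I}"

text \<open>
  Powers of ideals are taken in the multiplicative monoid of ideals, so the zeroth power is the
  whole ring.
\<close>

abbreviation ideal_power :: "('a, 'b) ring_scheme \<Rightarrow> 'a set \<Rightarrow> nat \<Rightarrow> 'a set" where
  "ideal_power R I n \<equiv> I [^]\<^bsub>ideals_set R\<^esub> n"

definition ratliff_rush :: "('a, 'b) ring_scheme \<Rightarrow> 'a set \<Rightarrow> 'a set" where
  "ratliff_rush R I = (\<Union>l\<in>{1..}. colon_ideal R (ideal_power R I (l + 1)) (ideal_power R I l))"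

definition rr_reduction_number :: "('a, 'b) ring_scheme \<Rightarrow> 'a set \<Rightarrow> nat" where
  "rr_reduction_number R I =
     (LEAST l. ratliff_rush R I = colon_ideal R (ideal_power R I (l + 1)) (ideal_power R I l))"


section \<open>Monomial ideals in two variables\<close>

definition monomial_ideal ::
    "'a::comm_ring_1 \<Rightarrow> 'a \<Rightarrow> (nat \<Rightarrow> nat) \<Rightarrow> (nat \<Rightarrow> nat) \<Rightarrow> nat \<Rightarrow> 'a set" where
  "monomial_ideal x y a b r =
     Idl\<^bsub>ring_of_type_algebra\<^esub> {x ^ a i * y ^ b i | i. i \<le> r}"

text \<open>
  \<open>k[x,y]\<close> and \<open>k[[x,y]]\<close> are represented as \<open>k[x][y]\<close> and \<open>k[[x]][[y]]\<close>: the inner variable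
  is \<open>x\<close>, the outer one is \<open>y\<close>.
\<close>

definition poly_x :: "'k::field poly poly" where "poly_x = [:[:0, 1:]:]"
definition poly_y :: "'k::field poly poly" where "poly_y = [:0, 1:]"

definition fps_x :: "'k::field fps fps" where "fps_x = fps_const fps_X"
definition fps_y :: "'k::field fps fps" where "fps_y = fps_X"

end

theory Submission
  imports Defs
begin

text \<open>
  All ideals involved are monomial, so everything reduces to exponents. The power \<open>I\<^sup>n\<close> is generated by
  the monomials \<open>x\<^sup>p y\<^sup>q\<close> with \<open>p + q = n d\<close> and \<open>p\<close> a sum of \<open>n\<close> generators of \<open>S\<close>. Subtracting \<open>d\<close>
  repeatedly shows that every \<open>s \<in> S\<close> with \<open>s \<le> g(S) + d + j d\<close> is a sum of \<open>\<Lambda>(S) + j\<close> generators.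

  Suppose that \<open>x\<^sup>u y\<^sup>v\<close> with \<open>u, v < d\<close> multiplies \<open>I\<^sup>m\<close> into \<open>I\<^sup>m\<^sup>+\<^sup>1\<close> for some \<open>m\<close>, and let \<open>x\<^sup>p y\<^sup>q\<close> be a
  generator of \<open>I\<^sup>L\<close>. After multiplication by a large power of \<open>y\<^sup>d\<close>, respectively of \<open>x\<^sup>d\<close>, the hypothesis
  yields \<open>p' \<in> S\<close> and \<open>q' \<in> T\<close> such that \<open>x\<^sup>p\<^sup>+\<^sup>u y\<^sup>q\<^sup>+\<^sup>v\<close> is divisible by a monomial of degree \<open>(L + 1) d\<close>
  with first exponent \<open>p'\<close>, and by one with second exponent \<open>q'\<close>. One of these lies in \<open>I\<^sup>L\<^sup>+\<^sup>1\<close> unless both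
  \<open>p'\<close> and \<open>q'\<close> are too large for the length bound; but \<open>p' + q' \<le> p + q + u + v < (L + 2) d\<close>, and
  this excludes that for \<open>L\<close> as in the theorem.
\<close>

section \<open>Representations in numerical semigroups\<close>

locale generating_family =
  fixes c :: "nat \<Rightarrow> nat" and r d :: nat
  assumes zero_generator: "\<exists>i\<le>r. c i = 0"
    and top_generator: "\<exists>i\<le>r. c i = d"
    and generator_le: "\<And>i. i \<le> r \<Longrightarrow> c i \<le> d"
    and top_pos: "0 < d"
begin

abbreviation "S \<equiv> num_semigroup c r"
abbreviation "h \<equiv> Gcd (c ` {..r})"
abbreviation "g \<equiv> frobenius_number c r"
abbreviation "\<Lambda> \<equiv> max_gen_length c r"

lemma Max_generators: "Max (c ` {..r}) = d"
  using top_generator generator_le by (intro Max_eqI) auto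

lemma semigroupI: "s = (\<Sum>i\<le>r. l i * c i) \<Longrightarrow> s \<in> S"
  unfolding num_semigroup_def by auto

lemma zero_in_semigroup: "0 \<in> S"
  by (rule semigroupI[of _ "\<lambda>_. 0"]) simp

lemma add_in_semigroup: "s \<in> S \<Longrightarrow> t \<in> S \<Longrightarrow> s + t \<in> S"
  unfolding num_semigroup_def
  by (auto simp: sum.distrib[symmetric] add_mult_distrib[symmetric])

lemma mult_in_semigroup: "s \<in> S \<Longrightarrow> n * s \<in> S"
  by (induction n) (auto intro: zero_in_semigroup add_in_semigroup)

lemma sum_single_generator:
  "i \<le> r \<Longrightarrow> (\<Sum>j\<le>r. (if j = i then 1 else 0) * c j) = c i"
  by (simp add: if_distrib[of "\<lambda>x. x * _"] cong: if_cong)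

lemma generator_in_semigroup: "i \<le> r \<Longrightarrow> c i \<in> S"
  by (rule semigroupI[OF sum_single_generator[symmetric]])

lemma Gcd_dvd_semigroup: "s \<in> S \<Longrightarrow> h dvd s"
  unfolding num_semigroup_def using Gcd_dvd[of _ "c ` {..r}"] by (force intro: dvd_sum dvd_mult)

lemma Gcd_pos: "0 < h"
proof -
  have "h dvd d" using top_generator by (auto intro!: Gcd_dvd)
  then show ?thesis using top_pos by (metis dvd_0_left_iff gr0I)
qed

lemma Gcd_le_top: "h \<le> d"
proof -
  have "h dvd d" using top_generator by (auto intro!: Gcd_dvd)
  then show ?thesis using top_pos by (simp add: dvd_imp_le)
qed

section \<open>Gaps among the multiples of the gcd, and the Frobenius number\<close>

text \<open>Differences of elements of \<open>S\<close> form a group, which contains every Bezout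
  combination. The two cases record on which side the subtraction falls.\<close>

lemma Gcd_diff_semigroup:
  assumes "finite F" "F \<subseteq> S"
  shows "\<exists>p\<in>S. \<exists>n\<in>S. p = n + Gcd F"
  using assms
proof (induction F rule: finite_induct)
  case empty
  then show ?case using zero_in_semigroup by auto
next
  case (insert x F)
  then obtain p n where pn: "p \<in> S" "n \<in> S" "p = n + Gcd F" by auto
  have x: "x \<in> S" using insert by auto
  define G where "G = Gcd F"
  have G: "Gcd (insert x F) = gcd x G" by (simp add: G_def)
  obtain u v where "G * v \<le> x * u \<and> x * u - G * v = gcd x G \<or>
      x * v \<le> G * u \<and> G * u - x * v = gcd x G"
    using bezout_gcd_nat'[of G x] by auto
  then consider "x * u = G * v + gcd x G" | "G * u = x * v + gcd x G"
    by (metis add.commute le_add_diff_inverse2)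
  then show ?case
  proof cases
    case 1
    then have "u * x + v * n = v * p + Gcd (insert x F)"
      unfolding G pn(3) G_def[symmetric] by (simp add: algebra_simps)
    then show ?thesis using x pn by (metis mult_in_semigroup add_in_semigroup)
  next
    case 2
    then have "u * p = (v * x + u * n) + Gcd (insert x F)"
      unfolding G pn(3) G_def[symmetric] by (simp add: algebra_simps)
    then show ?thesis using x pn by (metis mult_in_semigroup add_in_semigroup)
  qed
qed

text \<open>With \<open>n = q h\<close> and \<open>p = (q + 1) h\<close> in \<open>S\<close>, write
  \<open>k = u q + w\<close> where \<open>w < q \<le> u\<close>; then
  \<open>k h = (u - w) n + w p\<close>.\<close>

lemma semigroup_cofinite:
  obtains K where "\<And>k. K \<le> k \<Longrightarrow> k * h \<in> S"
proof -
  obtain p n where pn: "p \<in> S" "n \<in> S" "p = n + h"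
    using Gcd_diff_semigroup[of "c ` {..r}"] generator_in_semigroup by auto
  obtain q where q: "n = q * h"
    using Gcd_dvd_semigroup[OF pn(2)] by (metis dvd_def mult.commute)
  show ?thesis
  proof (rule that[of "q * q"])
    fix k assume k: "q * q \<le> k"
    show "k * h \<in> S"
    proof (cases "q = 0")
      case True
      then show ?thesis using pn q by (simp add: mult_in_semigroup)
    next
      case False
      define u w where "u = k div q" and "w = k mod q"
      have "w < q" using False by (simp add: w_def)
      moreover have "q \<le> u"
        using k False by (simp add: u_def div_greater_zero_iff less_eq_div_iff_mult_less_eq)
      ultimately obtain v where v: "u = v + w" by (metis add.commute le_iff_add order.trans nat_less_le)
      have "k = u * q + w" by (simp add: u_def w_def)
      then have "k * h = v * n + w * p"
        unfolding pn(3) q v by (simp add: algebra_simps)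
      then show ?thesis using pn by (simp add: mult_in_semigroup add_in_semigroup)
    qed
  qed
qed

text \<open>Cofiniteness bounds the gaps that are multiples of \<open>h\<close>, and
  \<open>- h\<close> is one of them, so a greatest gap exists and is at least
  \<open>- h \<ge> - d\<close>.\<close>

lemma frobenius_number:
  shows frobenius_number_dvd: "int h dvd g"
    and frobenius_number_ge: "- int d \<le> g"
    and above_frobenius_number: "\<And>z. g < z \<Longrightarrow> int h dvd z \<Longrightarrow> z \<in> int ` S"
proof -
  let ?P = "\<lambda>z. int h dvd z \<and> z \<notin> int ` S"
  obtain K where K: "\<And>k. K \<le> k \<Longrightarrow> k * h \<in> S" by (rule semigroup_cofinite) auto
  have bound: "z < int (K * h)" if "?P z" for z
  proof (rule ccontr)
    assume "\<not> z < int (K * h)"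
    then have le: "int (K * h) \<le> z" by simp
    from that obtain k where k: "z = int h * k" by auto
    have "int K \<le> k" using le Gcd_pos unfolding k by (simp add: mult.commute)
    then have "z = int (nat k * h)" "K \<le> nat k" using k by auto
    then show False using that K by blast
  qed
  have neg: "?P (- int h)" using Gcd_pos by auto
  \<comment> \<open>\<open>Max\<close> needs a finite set, hence the cut at \<open>- h\<close>;
    smaller gaps lie below \<open>M\<close> anyway.\<close>
  define M where "M = Max {z. - int h \<le> z \<and> z < int (K * h) \<and> ?P z}"
  have fin: "finite {z. - int h \<le> z \<and> z < int (K * h) \<and> ?P z}"
    by (rule finite_subset[of _ "{- int h..int (K * h)}"]) auto
  have "- int h \<in> {z. - int h \<le> z \<and> z < int (K * h) \<and> ?P z}"
    using neg bound[OF neg] by blast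
  with fin have "M \<in> {z. - int h \<le> z \<and> z < int (K * h) \<and> ?P z}"
    unfolding M_def by (metis (no_types, lifting) Max_in empty_iff)
  then have M: "?P M" "- int h \<le> M" by auto
  have max: "z \<le> M" if "?P z" for z
  proof (cases "- int h \<le> z")
    case True
    then show ?thesis unfolding M_def using that bound[OF that] fin by (intro Max_ge) auto
  qed (use M in auto)
  have "g = M" unfolding frobenius_number_def using M max by (intro Greatest_equality) auto
  then show "int h dvd g" "- int d \<le> g"
    "\<And>z. g < z \<Longrightarrow> int h dvd z \<Longrightarrow> z \<in> int ` S"
    using M max Gcd_le_top by force+
qed

section \<open>Lengths of representations\<close>

lemma gen_length_attained:
  assumes "s \<in> S"
  obtains l where "(\<Sum>i\<le>r. l i) = gen_length c r s" "s = (\<Sum>i\<le>r. l i * c i)"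
proof -
  have "\<exists>n. \<exists>l :: nat \<Rightarrow> nat. n = (\<Sum>i\<le>r. l i) \<and> s = (\<Sum>i\<le>r. l i * c i)"
    using assms unfolding num_semigroup_def by auto
  from LeastI_ex[OF this] show ?thesis unfolding gen_length_def[symmetric] using that by metis
qed

lemma gen_length_le_max:
  assumes "s \<in> S" "int s \<le> g + int d"
  shows "gen_length c r s \<le> \<Lambda>"
proof -
  have "finite {s \<in> S. int s \<le> g + int d}"
    by (rule finite_subset[of _ "{..nat (g + int d)}"]) auto
  then show ?thesis
    unfolding max_gen_length_def Max_generators using assms by (intro Max_ge) auto
qed

text \<open>\<open>g + d\<close> is a multiple of \<open>h\<close> above \<open>g\<close>, hence an
  element of \<open>S\<close> that is a sum of at most \<open>\<Lambda>\<close> generators, each at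
  most \<open>d\<close>.\<close>

lemma max_gen_length_ge: "g + int d \<le> int (\<Lambda> * d)"
proof -
  have "int h dvd int d" using top_generator by (auto intro!: Gcd_dvd)
  then have "int h dvd g + int d" by (simp add: frobenius_number_dvd)
  then have "g + int d \<in> int ` S" using top_pos by (intro above_frobenius_number) auto
  then obtain s where s: "s \<in> S" "g + int d = int s" by auto
  obtain l where l: "(\<Sum>i\<le>r. l i) = gen_length c r s" "s = (\<Sum>i\<le>r. l i * c i)"
    using gen_length_attained s by blast
  have "s \<le> (\<Sum>i\<le>r. l i * d)" unfolding l(2) using generator_le by (intro sum_mono) auto
  also have "\<dots> = gen_length c r s * d" by (simp add: sum_distrib_right[symmetric] l(1))
  also have "\<dots> \<le> \<Lambda> * d" using gen_length_le_max[of s] s by simp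
  finally show ?thesis unfolding s(2) by (rule of_nat_mono)
qed

text \<open>An element above \<open>g + d\<close> stays in \<open>S\<close> when \<open>d\<close> is
  removed, the difference being a multiple of \<open>h\<close> above \<open>g\<close>. Each removal
  costs one generator.\<close>

lemma short_representation:
  assumes "s \<in> S" "int s \<le> g + int d + int (j * d)"
  shows "\<exists>l. (\<Sum>i\<le>r. l i) \<le> \<Lambda> + j \<and> s = (\<Sum>i\<le>r. l i * c i)"
  using assms
proof (induction j arbitrary: s)
  case 0
  then show ?case using gen_length_attained[of s] gen_length_le_max[of s]
    by (metis add_0_right mult_0 of_nat_0)
next
  case (Suc j)
  show ?case
  proof (cases "int s \<le> g + int d")
    case True
    then show ?thesis using gen_length_attained[of s] gen_length_le_max[of s] Suc.prems
      by (metis trans_le_add1)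
  next
    case False
    have "int h dvd int d" "int h dvd int s"
      using top_generator Gcd_dvd_semigroup[OF Suc.prems(1)] by (auto intro!: Gcd_dvd)
    then have "int s - int d \<in> int ` S" using False by (intro above_frobenius_number) auto
    then obtain t where t: "t \<in> S" "s = t + d" by force
    then obtain l where l: "(\<Sum>i\<le>r. l i) \<le> \<Lambda> + j" "t = (\<Sum>i\<le>r. l i * c i)"
      using Suc.IH[of t] Suc.prems by (auto simp: algebra_simps)
    obtain m where m: "m \<le> r" "c m = d" using top_generator by auto
    let ?e = "\<lambda>j. if j = m then 1 else 0 :: nat"
    have "(\<Sum>i\<le>r. l i + ?e i) \<le> \<Lambda> + Suc j" using l m by (simp add: sum.distrib)
    moreover have "s = (\<Sum>i\<le>r. (l i + ?e i) * c i)"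
      unfolding add_mult_distrib sum.distrib sum_single_generator[OF m(1)] using l t m by simp
    ultimately show ?thesis by blast
  qed
qed

text \<open>Copies of the generator 0 pad a short representation to exactly \<open>n\<close>
  summands.\<close>

lemma exact_representation:
  assumes "s \<in> S" "int s \<le> g + int d + int (j * d)" "\<Lambda> + j \<le> n"
  shows "\<exists>l. (\<Sum>i\<le>r. l i) = n \<and> s = (\<Sum>i\<le>r. l i * c i)"
proof -
  obtain l where l: "(\<Sum>i\<le>r. l i) \<le> n" "s = (\<Sum>i\<le>r. l i * c i)"
    using short_representation[OF assms(1,2)] assms(3) by (metis order.trans)
  obtain m where m: "m \<le> r" "c m = 0" using zero_generator by auto
  let ?e = "\<lambda>j. (n - (\<Sum>i\<le>r. l i)) * (if j = m then 1 else 0)"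
  have "(\<Sum>i\<le>r. l i + ?e i) = n" using l m by (simp add: sum.distrib sum_distrib_left[symmetric])
  moreover have "s = (\<Sum>i\<le>r. (l i + ?e i) * c i)"
    unfolding add_mult_distrib sum.distrib mult.assoc sum_distrib_left[symmetric]
      sum_single_generator[OF m(1)] using l m by simp
  ultimately show ?thesis by blast
qed

end


section \<open>Exponents of powers and colon ideals\<close>

text \<open>Exponents of the products of \<open>n\<close> generators, that is, of the monomials
  generating \<open>I^n\<close>.\<close>

definition exponents :: "(nat \<Rightarrow> nat) \<Rightarrow> (nat \<Rightarrow> nat) \<Rightarrow> nat \<Rightarrow> nat \<Rightarrow> (nat \<times> nat) set" where
  "exponents a b r n = {(\<Sum>i\<le>r. l i * a i, \<Sum>i\<le>r. l i * b i) | l. (\<Sum>i\<le>r. l i) = n}"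

lemma exponents_0: "exponents a b r 0 = {(0, 0)}"
  unfolding exponents_def by (auto intro!: exI[of _ "\<lambda>_. 0"])

lemma exponents_Suc:
  "exponents a b r (Suc n) = {(p + a i, q + b i) | p q i. (p, q) \<in> exponents a b r n \<and> i \<le> r}"
proof (intro equalityI subsetI)
  fix z assume "z \<in> exponents a b r (Suc n)"
  then obtain l where l: "z = (\<Sum>i\<le>r. l i * a i, \<Sum>i\<le>r. l i * b i)" "(\<Sum>i\<le>r. l i) = Suc n"
    unfolding exponents_def by auto
  have "\<exists>m\<le>r. l m \<noteq> 0"
  proof (rule ccontr)
    assume "\<not> (\<exists>m\<le>r. l m \<noteq> 0)"
    then have "(\<Sum>i\<le>r. l i) = 0" by simp
    with l show False by simp
  qed
  then obtain m where m: "m \<le> r" "l m \<noteq> 0" by blast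
  define l' where "l' = l(m := l m - 1)"
  have split: "(\<Sum>i\<le>r. l i * f i) = (\<Sum>i\<le>r. l' i * f i) + f m" for f :: "nat \<Rightarrow> nat"
  proof -
    have "l m * f m = l' m * f m + f m" using m by (cases "l m") (auto simp: l'_def)
    then show ?thesis using m by (simp add: sum.remove[of "{..r}" m] l'_def)
  qed
  have "(\<Sum>i\<le>r. l' i) = n" using split[of "\<lambda>_. 1"] l by simp
  then have "(\<Sum>i\<le>r. l' i * a i, \<Sum>i\<le>r. l' i * b i) \<in> exponents a b r n"
    unfolding exponents_def by blast
  then show "z \<in> {(p + a i, q + b i) | p q i. (p, q) \<in> exponents a b r n \<and> i \<le> r}"
    unfolding l(1) split using m by blast
next
  fix z assume "z \<in> {(p + a i, q + b i) | p q i. (p, q) \<in> exponents a b r n \<and> i \<le> r}"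
  then obtain l m where l: "(\<Sum>i\<le>r. l i) = n" "m \<le> r"
      "z = ((\<Sum>i\<le>r. l i * a i) + a m, (\<Sum>i\<le>r. l i * b i) + b m)"
    unfolding exponents_def by auto
  let ?l = "\<lambda>i. l i + (if i = m then 1 else 0)"
  have "(\<Sum>i\<le>r. ?l i * f i) = (\<Sum>i\<le>r. l i * f i) + f m" for f :: "nat \<Rightarrow> nat"
    using l(2) by (simp add: add_mult_distrib sum.distrib if_distrib[of "\<lambda>x. x * _"] cong: if_cong)
  note sums = this
  have "(\<Sum>i\<le>r. ?l i) = Suc n" using sums[of "\<lambda>_. 1"] l by simp
  then have "(\<Sum>i\<le>r. ?l i * a i, \<Sum>i\<le>r. ?l i * b i) \<in> exponents a b r (Suc n)"
    unfolding exponents_def by (intro CollectI exI[of _ ?l] conjI refl)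
  then show "z \<in> exponents a b r (Suc n)" unfolding l(3) sums .
qed

lemma exponents_1: "exponents a b r 1 = (\<lambda>i. (a i, b i)) ` {..r}"
  unfolding One_nat_def exponents_Suc exponents_0 by auto

lemma finite_exponents: "finite (exponents a b r n)"
proof (induction n)
  case (Suc n)
  have "exponents a b r (Suc n)
      \<subseteq> (\<lambda>((p, q), i). (p + a i, q + b i)) ` (exponents a b r n \<times> {..r})"
    unfolding exponents_Suc by force
  then show ?case by (rule finite_subset) (use Suc in auto)
qed (simp add: exponents_0)

section \<open>Exponents of colon ideals\<close>

text \<open>Membership of \<open>x^u y^v\<close> in \<open>(I^(n+1) : I^n)\<close>, tested on
  generators and expressed by divisibility.\<close>

definition colon_exponent ::
    "(nat \<Rightarrow> nat) \<Rightarrow> (nat \<Rightarrow> nat) \<Rightarrow> nat \<Rightarrow> nat \<Rightarrow> nat \<Rightarrow> nat \<Rightarrow> bool" where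
  "colon_exponent a b r n u v \<longleftrightarrow>
     (\<forall>(p, q)\<in>exponents a b r n. \<exists>(p', q')\<in>exponents a b r (Suc n). p' \<le> p + u \<and> q' \<le> q + v)"

lemma colon_exponentD:
  assumes "colon_exponent a b r n u v" "(p, q) \<in> exponents a b r n"
  obtains p' q' where "(p', q') \<in> exponents a b r (Suc n)" "p' \<le> p + u" "q' \<le> q + v"
  using assms unfolding colon_exponent_def by blast

text \<open>A generator of \<open>I^(n+1)\<close> is one of \<open>I^n\<close> times one of
  \<open>I\<close>; the last factor is carried along unchanged.\<close>

lemma colon_exponent_Suc:
  assumes "colon_exponent a b r n u v"
  shows "colon_exponent a b r (Suc n) u v"
  unfolding colon_exponent_def
proof clarify
  fix p q assume "(p, q) \<in> exponents a b r (Suc n)"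
  then obtain p0 q0 i where pq: "(p0, q0) \<in> exponents a b r n" "i \<le> r" "p = p0 + a i" "q = q0 + b i"
    unfolding exponents_Suc[of a b r n] by auto
  then obtain p' q' where "(p', q') \<in> exponents a b r (Suc n)" "p' \<le> p0 + u" "q' \<le> q0 + v"
    using colon_exponentD[OF assms] by metis
  then show "\<exists>(p', q')\<in>exponents a b r (Suc (Suc n)). p' \<le> p + u \<and> q' \<le> q + v"
    using pq unfolding exponents_Suc[of a b r "Suc n"]
    by (intro bexI[of _ "(p' + a i, q' + b i)"]) auto
qed

lemma colon_exponent_mono:
  assumes "colon_exponent a b r m u v" "m \<le> n"
  shows "colon_exponent a b r n u v"
  using assms(2,1) by (induction rule: dec_induct) (auto intro: colon_exponent_Suc)

text \<open>The trace of the primary hypothesis on exponents: \<open>x^d\<close> and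
  \<open>y^d\<close> are among the generators, and the ideal is proper.\<close>

locale equigenerated_exponents =
  fixes a b :: "nat \<Rightarrow> nat" and r d :: nat
  assumes same_degree: "\<And>i. i \<le> r \<Longrightarrow> a i + b i = d"
    and y_power: "\<exists>i\<le>r. a i = 0"
    and x_power: "\<exists>i\<le>r. b i = 0"
    and degree_pos: "0 < d"
begin

sublocale A: generating_family a r d
  using same_degree y_power x_power degree_pos
  by unfold_locales (metis add.right_neutral add_0 le_add1)+

sublocale B: generating_family b r d
  using same_degree y_power x_power degree_pos
  by unfold_locales (metis add.right_neutral add_0 le_add2)+

lemma exponents_degree:
  assumes "(\<Sum>i\<le>r. l i) = n"
  shows "(\<Sum>i\<le>r. l i * a i) + (\<Sum>i\<le>r. l i * b i) = n * d"
proof -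
  have "(\<Sum>i\<le>r. l i * a i) + (\<Sum>i\<le>r. l i * b i) = (\<Sum>i\<le>r. l i * d)"
    unfolding sum.distrib[symmetric]
    by (intro sum.cong) (auto simp: same_degree[symmetric] algebra_simps)
  then show ?thesis by (simp add: sum_distrib_right[symmetric] assms)
qed

lemma exponentsD:
  assumes "(p, q) \<in> exponents a b r n"
  shows "p \<in> A.S" "q \<in> B.S" "p + q = n * d"
  using assms exponents_degree unfolding exponents_def num_semigroup_def by auto

lemma exponents_shift:
  assumes "(p, q) \<in> exponents a b r n"
  shows "(p + j * d, q) \<in> exponents a b r (n + j)" "(p, q + j * d) \<in> exponents a b r (n + j)"
proof -
  have step: "(p + a i, q + b i) \<in> exponents a b r (Suc n)"
    if "(p, q) \<in> exponents a b r n" "i \<le> r" for p q n i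
    using that unfolding exponents_Suc by blast
  obtain i where i: "i \<le> r" "a i = d" "b i = 0" using x_power same_degree by fastforce
  show "(p + j * d, q) \<in> exponents a b r (n + j)"
  proof (induction j)
    case (Suc j)
    from step[OF this i(1)] show ?case using i by (simp add: algebra_simps)
  qed (use assms in simp)
  obtain i where i: "i \<le> r" "a i = 0" "b i = d" using y_power same_degree by fastforce
  show "(p, q + j * d) \<in> exponents a b r (n + j)"
  proof (induction j)
    case (Suc j)
    from step[OF this i(1)] show ?case using i by (simp add: algebra_simps)
  qed (use assms in simp)
qed

text \<open>The degree fixes the second exponent, so it suffices to write \<open>p\<close> as a sum
  of exactly \<open>n\<close> generators of \<open>S\<close>.\<close>

lemma exponents_of_first:
  assumes "p \<in> A.S" "int p \<le> A.g + int d + int (j * d)" "A.\<Lambda> + j \<le> n" "p + q = n * d"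
  shows "(p, q) \<in> exponents a b r n"
proof -
  obtain l where l: "(\<Sum>i\<le>r. l i) = n" "p = (\<Sum>i\<le>r. l i * a i)"
    using A.exact_representation[OF assms(1-3)] by blast
  then have "q = (\<Sum>i\<le>r. l i * b i)" using exponents_degree[OF l(1)] assms(4) by simp
  with l show ?thesis unfolding exponents_def by blast
qed

lemma exponents_of_second:
  assumes "q \<in> B.S" "int q \<le> B.g + int d + int (j * d)" "B.\<Lambda> + j \<le> n" "p + q = n * d"
  shows "(p, q) \<in> exponents a b r n"
proof -
  obtain l where l: "(\<Sum>i\<le>r. l i) = n" "q = (\<Sum>i\<le>r. l i * b i)"
    using B.exact_representation[OF assms(1-3)] by blast
  then have "p = (\<Sum>i\<le>r. l i * a i)" using exponents_degree[OF l(1)] assms(4) by simp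
  with l show ?thesis unfolding exponents_def by blast
qed

text \<open>\<open>LA\<close> and \<open>LB\<close> are the bound on \<open>L\<close> with the
  denominator \<open>d\<close> cleared, over the integers because Frobenius numbers may be
  negative.\<close>

lemma colon_exponent_stable:
  assumes LA: "2 * int A.\<Lambda> * int d + 2 * int d - (A.g + 1) \<le> (int L + 1) * int d"
    and LB: "2 * int B.\<Lambda> * int d + 2 * int d - (B.g + 1) \<le> (int L + 1) * int d"
    and C: "colon_exponent a b r m u v"
  shows "colon_exponent a b r L u v"
  unfolding colon_exponent_def
proof clarify
  fix p q assume pq: "(p, q) \<in> exponents a b r L"
  note pqD = exponentsD[OF pq]
  show "\<exists>(p', q')\<in>exponents a b r (Suc L). p' \<le> p + u \<and> q' \<le> q + v"
  proof (cases "d \<le> u \<or> d \<le> v")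
    case True
    \<comment> \<open>The multiplier is itself divisible by the generator \<open>x^d\<close> or
      \<open>y^d\<close>.\<close>
    have "(p + d, q) \<in> exponents a b r (Suc L)" "(p, q + d) \<in> exponents a b r (Suc L)"
      using exponents_shift[OF pq, of 1] by simp_all
    with True show ?thesis
      by (metis (mono_tags, lifting) add_left_mono case_prodI le_add1)
  next
    case False
    \<comment> \<open>\<open>L + M\<close> is the maximum of \<open>m\<close> and \<open>L\<close>,
      so the hypothesis on \<open>m\<close> carries over to this level.\<close>
    define M where "M = max m L - L"
    have CM: "colon_exponent a b r (L + M) u v"
      using C by (rule colon_exponent_mono) (simp add: M_def)
    \<comment> \<open>Multiplication by \<open>y^(M d)\<close> leaves the first exponent bounded by
      \<open>p + u\<close>; below, \<open>x^(M d)\<close> does the same for the second.\<close>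
    obtain p1 q1 where 1: "(p1, q1) \<in> exponents a b r (Suc (L + M))"
        "p1 \<le> p + u" "q1 \<le> q + M * d + v"
      using colon_exponentD[OF CM exponents_shift(2)[OF pq]] by metis
    obtain p2 q2 where 2: "(p2, q2) \<in> exponents a b r (Suc (L + M))"
        "p2 \<le> p + M * d + u" "q2 \<le> q + v"
      using colon_exponentD[OF CM exponents_shift(1)[OF pq]] by metis
    note D1 = exponentsD[OF 1(1)] and D2 = exponentsD[OF 2(1)]
    \<comment> \<open>Comparing degrees gives \<open>(L + 1) d - p1 \<le> q + v\<close>, the
      condition on the second exponent once the degree is lowered to
      \<open>(L + 1) d\<close>.\<close>
    have le1: "p + d \<le> p1 + v" using 1(3) D1(3) pqD(3) by (simp add: algebra_simps)
    have le2: "q + d \<le> q2 + u" using 2(2) D2(3) pqD(3) by (simp add: algebra_simps)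
    \<comment> \<open>This keeps the subtractions defining \<open>jA\<close> and \<open>jB\<close>
      from truncating.\<close>
    have le_Suc: "\<Lambda> \<le> Suc L"
      if "2 * int \<Lambda> * int d + 2 * int d - (g + 1) \<le> (int L + 1) * int d" "g + int d \<le> int (\<Lambda> * d)"
      for \<Lambda> g
    proof (rule ccontr)
      assume "\<not> \<Lambda> \<le> Suc L"
      then have "int (Suc (Suc L)) * int d \<le> int \<Lambda> * int d" by (intro mult_right_mono) auto
      then show False using that degree_pos by (simp add: algebra_simps)
    qed
    have LA': "A.\<Lambda> \<le> Suc L" by (rule le_Suc[OF LA A.max_gen_length_ge])
    have LB': "B.\<Lambda> \<le> Suc L" by (rule le_Suc[OF LB B.max_gen_length_ge])
    \<comment> \<open>The largest \<open>j\<close> that the length bound permits for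
      \<open>L + 1\<close> summands.\<close>
    define jA where "jA = Suc L - A.\<Lambda>"
    define jB where "jB = Suc L - B.\<Lambda>"
    have jA: "int (jA * d) = (int L + 1) * int d - int A.\<Lambda> * int d"
      using LA' unfolding jA_def of_nat_mult by (simp only: of_nat_diff) (simp add: algebra_simps)
    have jB: "int (jB * d) = (int L + 1) * int d - int B.\<Lambda> * int d"
      using LB' unfolding jB_def of_nat_mult by (simp only: of_nat_diff) (simp add: algebra_simps)
    \<comment> \<open>Otherwise \<open>p1 + q2\<close> would exceed \<open>L d + 2 d\<close>: average the two assumptions on \<open>L\<close>
      and use that both Frobenius numbers are at least \<open>- d\<close>.\<close>
    have "int p + int q = int L * int d" using pqD(3) by (metis of_nat_add of_nat_mult)
    then have "int p1 + int q2 \<le> int L * int d + 2 * int d" using 1(2) 2(3) False by linarith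
    then have "int p1 \<le> A.g + int d + int (jA * d) \<or> int q2 \<le> B.g + int d + int (jB * d)"
      using LA LB A.frobenius_number_ge B.frobenius_number_ge degree_pos
      unfolding jA jB by (auto simp: algebra_simps)
    then show ?thesis
    proof
      assume le: "int p1 \<le> A.g + int d + int (jA * d)"
      \<comment> \<open>The subtraction is exact since
        \<open>p1 \<le> p + u < (L + 1) d\<close>.\<close>
      have "p1 + (Suc L * d - p1) = Suc L * d" using 1(2) pqD(3) False by simp
      then have "(p1, Suc L * d - p1) \<in> exponents a b r (Suc L)"
        using D1(1) le LA' by (intro exponents_of_first[where j = jA]) (auto simp: jA_def)
      then show ?thesis using 1(2) le1 pqD(3) by (auto intro!: bexI[of _ "(p1, Suc L * d - p1)"])
    next
      assume le: "int q2 \<le> B.g + int d + int (jB * d)"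
      have "(Suc L * d - q2) + q2 = Suc L * d" using 2(3) pqD(3) False by simp
      then have "(Suc L * d - q2, q2) \<in> exponents a b r (Suc L)"
        using D2(2) le LB' by (intro exponents_of_second[where j = jB]) (auto simp: jB_def)
      then show ?thesis using 2(3) le2 pqD(3) by (auto intro!: bexI[of _ "(Suc L * d - q2, q2)"])
    qed
  qed
qed

end


section \<open>Monomial ideals in a ring with bivariate coefficients\<close>

lemma ring_of_type_algebra_simps [simp]:
  "carrier ring_of_type_algebra = UNIV"
  "x \<otimes>\<^bsub>ring_of_type_algebra\<^esub> y = x * y"
  "x \<oplus>\<^bsub>ring_of_type_algebra\<^esub> y = x + y"
  "\<zero>\<^bsub>ring_of_type_algebra\<^esub> = 0"
  "\<one>\<^bsub>ring_of_type_algebra\<^esub> = 1"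
  by (simp_all add: ring_of_type_algebra_def)

lemma ring_of_type_algebra_power [simp]: "x [^]\<^bsub>ring_of_type_algebra\<^esub> (n :: nat) = x ^ n"
  by (induction n) (simp_all add: nat_pow_def power_commutes)

lemma ideal_ring_of_type_algebraI:
  fixes I :: "'a :: comm_ring_1 set"
  assumes "0 \<in> I" "\<And>f g. f \<in> I \<Longrightarrow> g \<in> I \<Longrightarrow> f + g \<in> I" "\<And>f g. f \<in> I \<Longrightarrow> g * f \<in> I"
  shows "ideal I ring_of_type_algebra"
proof -
  interpret R: cring "ring_of_type_algebra :: 'a ring" by (rule cring_from_type_algebra)
  have inv: "inv\<^bsub>add_monoid ring_of_type_algebra\<^esub> f = - f" for f :: 'a
    using R.minus_equality[of "- f" f] by (simp add: a_inv_def)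
  have minus: "- f \<in> I" if "f \<in> I" for f using assms(3)[OF that, of "- 1"] by simp
  show ?thesis
  proof (rule idealI[OF R.ring_axioms])
    show "subgroup I (add_monoid ring_of_type_algebra)"
      by (rule subgroup.intro) (simp_all only: inv, simp_all add: assms(1,2) minus)
  qed (use assms(3) in \<open>auto simp: mult.commute\<close>)
qed

lemma ideal_ring_of_type_algebraD:
  fixes I :: "'a :: comm_ring_1 set"
  assumes "ideal I ring_of_type_algebra"
  shows "0 \<in> I" "f \<in> I \<Longrightarrow> g \<in> I \<Longrightarrow> f + g \<in> I" "f \<in> I \<Longrightarrow> g * f \<in> I"
proof -
  interpret ideal I ring_of_type_algebra by fact
  show "0 \<in> I" using additive_subgroup.zero_closed[OF is_additive_subgroup] by simp
  show "f + g \<in> I" if "f \<in> I" "g \<in> I" 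
    using additive_subgroup.a_closed[OF is_additive_subgroup that] by simp
  show "g * f \<in> I" if "f \<in> I" using I_l_closed[OF that, of g] by simp
qed

text \<open>Common ground of polynomials and power series. Index \<open>i\<close> belongs to
  \<open>x\<close> and \<open>j\<close> to \<open>y\<close>; \<open>coeff_shift\<close> supplies
  quotients by monomials.\<close>

locale bivariate_ring =
  fixes coeff :: "'a::comm_ring_1 \<Rightarrow> nat \<Rightarrow> nat \<Rightarrow> 'k::ab_group_add" and x y :: 'a
  assumes coeff_add: "coeff (f + g) i j = coeff f i j + coeff g i j"
    and coeff_monom_mult:
      "coeff (x ^ u * y ^ v * f) i j = (if u \<le> i \<and> v \<le> j then coeff f (i - u) (j - v) else 0)"
    and coeff_eq_0_imp: "(\<And>i j. coeff f i j = 0) \<Longrightarrow> f = 0"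
    and coeff_shift: "\<exists>g. \<forall>i j. coeff g i j = coeff f (i + u) (j + v)"
    and coeff_one: "coeff 1 i j \<noteq> 0 \<longleftrightarrow> i = 0 \<and> j = 0"
begin

abbreviation (input) "R \<equiv> ring_of_type_algebra :: 'a ring"

text \<open>For finite \<open>E\<close> this is the monomial ideal with generators
  \<open>x^u y^v\<close>, \<open>(u, v) \<in> E\<close>, described through coefficients.\<close>

definition supported :: "(nat \<times> nat) set \<Rightarrow> 'a set" where
  "supported E = {f. \<forall>i j. coeff f i j \<noteq> 0 \<longrightarrow> (\<exists>(u, v)\<in>E. u \<le> i \<and> v \<le> j)}"

lemma coeff_0: "coeff 0 i j = 0"
  using coeff_add[of 0 0 i j] by simp

lemma coeff_minus: "coeff (- f) i j = - coeff f i j"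
  using coeff_add[of f "- f" i j] by (simp add: coeff_0 eq_neg_iff_add_eq_0 add.commute)

lemma coeff_diff: "coeff (f - g) i j = coeff f i j - coeff g i j"
  using coeff_add[of f "- g" i j] by (simp add: coeff_minus)

lemma coeff_monom: "coeff (x ^ u * y ^ v) i j \<noteq> 0 \<longleftrightarrow> i = u \<and> j = v"
  using coeff_monom_mult[of u v 1 i j] by (auto simp: coeff_one split: if_splits)

lemma monom_in_supported: "x ^ u * y ^ v \<in> supported E \<longleftrightarrow> (\<exists>(p, q)\<in>E. p \<le> u \<and> q \<le> v)"
  unfolding supported_def mem_Collect_eq coeff_monom by auto

lemma monom_in_supportedI: "(u, v) \<in> E \<Longrightarrow> x ^ u * y ^ v \<in> supported E"
  unfolding monom_in_supported by blast

lemma zero_in_supported: "0 \<in> supported E"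
  by (simp add: supported_def coeff_0)

lemma add_in_supported: "f \<in> supported E \<Longrightarrow> g \<in> supported E \<Longrightarrow> f + g \<in> supported E"
  unfolding supported_def mem_Collect_eq coeff_add by (metis add_0)

lemma monom_mult_in_supported:
  assumes "(u, v) \<in> E"
  shows "x ^ u * y ^ v * f \<in> supported E"
  unfolding supported_def mem_Collect_eq coeff_monom_mult using assms by auto

lemma supported_empty: "supported {} = {0}"
  using coeff_eq_0_imp by (auto simp: supported_def coeff_0)

text \<open>
  The part of \<open>f\<close> divisible by one of the monomials is split off by a coefficient shift; the
  remainder is supported on the remaining exponents.
\<close>

lemma supported_subset_ideal:
  assumes "ideal I R" "finite E" "\<And>u v. (u, v) \<in> E \<Longrightarrow> x ^ u * y ^ v \<in> I" "f \<in> supported E"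
  shows "f \<in> I"
  using assms(2-4)
proof (induction E arbitrary: f rule: finite_induct)
  case empty
  then show ?case using ideal_ring_of_type_algebraD(1)[OF assms(1)] by (simp add: supported_empty)
next
  case (insert e E)
  obtain u v where e: "e = (u, v)" by (cases e)
  obtain g where g: "\<And>i j. coeff g i j = coeff f (i + u) (j + v)" using coeff_shift by blast
  have "f - x ^ u * y ^ v * g \<in> supported E"
    using insert.prems(2) unfolding supported_def mem_Collect_eq coeff_diff coeff_monom_mult e
    by (auto simp: g split: if_splits)
  then have "f - x ^ u * y ^ v * g \<in> I" using insert by auto
  moreover have "g * (x ^ u * y ^ v) \<in> I"
    using insert.prems(1)[of u v] ideal_ring_of_type_algebraD(3)[OF assms(1)] by (auto simp: e)
  ultimately have "(f - x ^ u * y ^ v * g) + g * (x ^ u * y ^ v) \<in> I"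
    by (rule ideal_ring_of_type_algebraD(2)[OF assms(1)])
  then show ?case by (simp add: mult.commute)
qed

text \<open>Closure under arbitrary multiplication is obtained indirectly: \<open>?J\<close> is an
  ideal by construction and contains the monomials of \<open>E\<close>, hence all of
  \<open>supported E\<close>.\<close>

lemma ideal_supported:
  assumes "finite E"
  shows "ideal (supported E) R"
proof -
  let ?J = "{f. \<forall>g. g * f \<in> supported E}"
  have J: "ideal ?J R"
    by (rule ideal_ring_of_type_algebraI)
      (auto simp: zero_in_supported distrib_left mult.assoc[symmetric] intro: add_in_supported)
  have "g * f \<in> supported E" if "f \<in> supported E" for f g
    using supported_subset_ideal[OF J assms _ that] monom_mult_in_supported
    by (auto simp: mult.commute)
  then show ?thesis
    by (intro ideal_ring_of_type_algebraI) (auto simp: zero_in_supported intro: add_in_supported)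
qed

lemma genideal_monomials:
  assumes "finite E"
  shows "Idl\<^bsub>R\<^esub> ((\<lambda>(u, v). x ^ u * y ^ v) ` E) = supported E"
proof
  interpret R: cring R by (rule cring_from_type_algebra)
  let ?G = "(\<lambda>(u, v). x ^ u * y ^ v) ` E"
  have "?G \<subseteq> supported E" by (auto intro: monom_in_supportedI)
  then show "Idl\<^bsub>R\<^esub> ?G \<subseteq> supported E"
    by (rule R.genideal_minimal[OF ideal_supported[OF assms]])
  have "ideal (Idl\<^bsub>R\<^esub> ?G) R" "?G \<subseteq> Idl\<^bsub>R\<^esub> ?G"
    by (auto intro!: R.genideal_ideal R.genideal_self[THEN subsetD])
  then show "supported E \<subseteq> Idl\<^bsub>R\<^esub> ?G"
    using supported_subset_ideal assms by blast
qed

lemma ideal_prod_supported: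
  assumes "finite E" "finite F"
  shows "ideal_prod R (supported E) (supported F) =
    supported ((\<lambda>((p, q), (u, v)). (p + u, q + v)) ` (E \<times> F))" (is "_ = supported ?EF")
proof
  interpret R: cring R by (rule cring_from_type_algebra)
  have fin: "finite ?EF" using assms by simp
  note D = ideal_ring_of_type_algebraD[OF ideal_supported[OF fin]]
  have monom: "x ^ p * y ^ q * (x ^ u * y ^ v) = x ^ (p + u) * y ^ (q + v)" for p q u v
    by (simp add: power_add mult_ac)
  have prod: "f * g \<in> supported ?EF" if f: "f \<in> supported E" and g: "g \<in> supported F" for f g
  proof -
    \<comment> \<open>As these multipliers form an ideal, only monomials need checking; this is used
      for the factor \<open>f\<close> first and for \<open>g\<close> afterwards.\<close>
    have "ideal {g. g * m \<in> supported ?EF} R" for m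
      using D by (intro ideal_ring_of_type_algebraI) (auto simp: distrib_right mult.assoc)
    note colon = supported_subset_ideal[OF this]
    have "f * (x ^ u * y ^ v) \<in> supported ?EF" if "(u, v) \<in> F" for u v
      using colon[OF assms(1) _ f, of "x ^ u * y ^ v"] that
      by (force simp: monom monom_in_supported)
    then show ?thesis
      using colon[OF assms(2) _ g, of f] by (simp add: mult.commute)
  qed
  show "ideal_prod R (supported E) (supported F) \<subseteq> supported ?EF"
  proof
    fix s assume "s \<in> ideal_prod R (supported E) (supported F)"
    then show "s \<in> supported ?EF"
      by (induction s rule: ideal_prod.induct) (auto intro: prod add_in_supported)
  qed
  have "ideal (ideal_prod R (supported E) (supported F)) R"
    using assms by (intro R.ideal_prod_is_ideal ideal_supported)
  moreover have "x ^ u * y ^ v \<in> ideal_prod R (supported E) (supported F)"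
    if uv: "(u, v) \<in> ?EF" for u v
  proof -
    obtain p q u' v' where "(p, q) \<in> E" "(u', v') \<in> F" "u = p + u'" "v = q + v'"
      using uv by auto
    then show ?thesis
      using ideal_prod.prod[of "x ^ p * y ^ q" "supported E" "x ^ u' * y ^ v'" "supported F" R]
      by (force simp: monom_in_supported monom)
  qed
  ultimately show "supported ?EF \<subseteq> ideal_prod R (supported E) (supported F)"
    using supported_subset_ideal fin by blast
qed

lemma monomial_ideal_supported: "monomial_ideal x y a b r = supported (exponents a b r 1)"
proof -
  have "{x ^ a i * y ^ b i | i. i \<le> r} = (\<lambda>(u, v). x ^ u * y ^ v) ` exponents a b r 1"
    unfolding exponents_1 by auto
  then show ?thesis unfolding monomial_ideal_def using genideal_monomials finite_exponents by simp
qed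

lemma ideal_power_supported:
  "ideal_power R (monomial_ideal x y a b r) n = supported (exponents a b r n)"
proof (induction n)
  case 0
  have "supported {(0, 0)} = UNIV" by (auto simp: supported_def)
  then show ?case by (simp add: nat_pow_def ideals_set_def exponents_0)
next
  case (Suc n)
  have "ideal_power R (monomial_ideal x y a b r) (Suc n) =
      ideal_prod R (supported (exponents a b r n)) (supported (exponents a b r 1))"
    using Suc by (simp add: nat_pow_def ideals_set_def monomial_ideal_supported)
  also have "\<dots> = supported ((\<lambda>((p, q), (u, v)). (p + u, q + v)) `
      (exponents a b r n \<times> exponents a b r 1))"
    by (rule ideal_prod_supported[OF finite_exponents finite_exponents])
  also have "(\<lambda>((p, q), (u, v)). (p + u, q + v)) ` (exponents a b r n \<times> exponents a b r 1) =
      exponents a b r (Suc n)"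
    unfolding exponents_Suc exponents_1
    by (auto simp: image_iff) (force intro: bexI[of _ "((_, _), (_, _))"])
  finally show ?case .
qed

section \<open>Colon ideals and the reduction number\<close>

lemma colon_supported_iff:
  assumes "finite E" "finite F"
  shows "(\<forall>g\<in>supported E. f * g \<in> supported F) \<longleftrightarrow>
    (\<forall>(p, q)\<in>E. x ^ p * y ^ q * f \<in> supported F)"
proof
  assume *: "\<forall>g\<in>supported E. f * g \<in> supported F"
  have "x ^ p * y ^ q * f \<in> supported F" if "(p, q) \<in> E" for p q
    using *[rule_format, OF monom_in_supportedI[OF that]] by (simp only: mult.commute)
  then show "\<forall>(p, q)\<in>E. x ^ p * y ^ q * f \<in> supported F" by blast
next
  assume *: "\<forall>(p, q)\<in>E. x ^ p * y ^ q * f \<in> supported F"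
  note D = ideal_ring_of_type_algebraD[OF ideal_supported[OF assms(2)]]
  have "ideal {g. g * f \<in> supported F} R"
    using D by (intro ideal_ring_of_type_algebraI) (auto simp: distrib_right mult.assoc)
  note colon = supported_subset_ideal[OF this assms(1)]
  have "g * f \<in> supported F" if "g \<in> supported E" for g
    using colon[OF _ that] * by blast
  then show "\<forall>g\<in>supported E. f * g \<in> supported F" by (simp only: mult.commute[of f]) blast
qed

text \<open>Multiplication by a monomial shifts coefficients without cancellation, so the terms of
  \<open>f\<close> can be tested one by one.\<close>

lemma monom_mult_in_supported_iff:
  "x ^ p * y ^ q * f \<in> supported F \<longleftrightarrow>
    (\<forall>u v. coeff f u v \<noteq> 0 \<longrightarrow> (\<exists>(p', q')\<in>F. p' \<le> p + u \<and> q' \<le> q + v))"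
proof
  assume L: "x ^ p * y ^ q * f \<in> supported F"
  have "coeff (x ^ p * y ^ q * f) (p + u) (q + v) = coeff f u v" for u v
    by (simp add: coeff_monom_mult)
  then show "\<forall>u v. coeff f u v \<noteq> 0 \<longrightarrow> (\<exists>(p', q')\<in>F. p' \<le> p + u \<and> q' \<le> q + v)"
    using L unfolding supported_def mem_Collect_eq by metis
next
  assume C: "\<forall>u v. coeff f u v \<noteq> 0 \<longrightarrow> (\<exists>(p', q')\<in>F. p' \<le> p + u \<and> q' \<le> q + v)"
  have "\<exists>(u, v)\<in>F. u \<le> i \<and> v \<le> j" if "coeff (x ^ p * y ^ q * f) i j \<noteq> 0" for i j
  proof -
    have "p \<le> i" "q \<le> j" "coeff f (i - p) (j - q) \<noteq> 0"
      using that by (auto simp: coeff_monom_mult split: if_splits)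
    then show ?thesis using C[rule_format, of "i - p" "j - q"] by simp
  qed
  then show "x ^ p * y ^ q * f \<in> supported F" unfolding supported_def by blast
qed

text \<open>The colon ideal is again monomial: exchanging the quantifiers over generators and terms
  leaves a separate condition on each term.\<close>

lemma colon_ideal_power:
  "colon_ideal R (ideal_power R (monomial_ideal x y a b r) (n + 1))
     (ideal_power R (monomial_ideal x y a b r) n) =
   {f. \<forall>u v. coeff f u v \<noteq> 0 \<longrightarrow> colon_exponent a b r n u v}"
proof -
  have swap: "(\<forall>(p, q)\<in>E. \<forall>u v. P u v \<longrightarrow> Q p q u v) \<longleftrightarrow> (\<forall>u v. P u v \<longrightarrow> (\<forall>(p, q)\<in>E. Q p q u v))"
    for E :: "(nat \<times> nat) set" and P and Q :: "nat \<Rightarrow> nat \<Rightarrow> nat \<Rightarrow> nat \<Rightarrow> bool"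
    by fast
  show ?thesis
    unfolding colon_ideal_def ideal_power_supported ring_of_type_algebra_simps
      colon_supported_iff[OF finite_exponents finite_exponents] monom_mult_in_supported_iff
      colon_exponent_def swap
    by simp
qed

lemma rr_reduction_number_le:
  assumes "\<And>m u v. colon_exponent a b r m u v \<Longrightarrow> colon_exponent a b r L u v"
  shows "rr_reduction_number R (monomial_ideal x y a b r) \<le> L"
proof -
  let ?C = "\<lambda>n. {f. \<forall>u v. coeff f u v \<noteq> 0 \<longrightarrow> colon_exponent a b r n u v}"
  have "(\<Union>l\<in>{1..}. ?C l) = ?C L"
  proof
    show "(\<Union>l\<in>{1..}. ?C l) \<subseteq> ?C L" using assms by blast
    \<comment> \<open>The union starts at 1, so \<open>L = 0\<close> is covered by passing to the
      next level.\<close>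
    have "?C L \<subseteq> ?C (Suc L)" using colon_exponent_Suc by blast
    then show "?C L \<subseteq> (\<Union>l\<in>{1..}. ?C l)" by fastforce
  qed
  then show ?thesis
    unfolding rr_reduction_number_def ratliff_rush_def colon_ideal_power by (rule Least_le)
qed

text \<open>Some powers of \<open>x\<close> and \<open>y\<close> lie in the ideal, and a generator
  dividing a pure power is itself pure. A constant generator would make the ideal the whole
  ring.\<close>

lemma primary_imp_pure_powers:
  assumes "is_primary_to R (Idl\<^bsub>R\<^esub> {x, y}) (monomial_ideal x y a b r)"
  shows "\<exists>i\<le>r. a i = 0" "\<exists>i\<le>r. b i = 0" "\<not> (\<exists>i\<le>r. a i = 0 \<and> b i = 0)"
proof -
  interpret R: cring R by (rule cring_from_type_algebra)
  have "{x, y} \<subseteq> Idl\<^bsub>R\<^esub> {x, y}" by (rule R.genideal_self) simp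
  then have "x \<in> radical_ideal R (monomial_ideal x y a b r)"
      "y \<in> radical_ideal R (monomial_ideal x y a b r)"
    using assms unfolding is_primary_to_def by auto
  then obtain m n where "x ^ m * y ^ 0 \<in> monomial_ideal x y a b r"
      "x ^ 0 * y ^ n \<in> monomial_ideal x y a b r"
    unfolding radical_ideal_def by auto
  then show "\<exists>i\<le>r. a i = 0" "\<exists>i\<le>r. b i = 0"
    unfolding monomial_ideal_supported monom_in_supported exponents_1 by auto
  interpret I: primaryideal "monomial_ideal x y a b r" R
    using assms unfolding is_primary_to_def by simp
  show "\<not> (\<exists>i\<le>r. a i = 0 \<and> b i = 0)"
  proof
    assume "\<exists>i\<le>r. a i = 0 \<and> b i = 0"
    then have "x ^ 0 * y ^ 0 \<in> monomial_ideal x y a b r"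
      unfolding monomial_ideal_supported monom_in_supported exponents_1 by auto
    then show False using I.one_imp_carrier I.I_notcarr by simp
  qed
qed

lemma rr_reduction_number_bound:
  assumes same_degree: "\<And>i. i \<le> r \<Longrightarrow> a i + b i = d"
    and primary: "is_primary_to R (Idl\<^bsub>R\<^esub> {x, y}) (monomial_ideal x y a b r)"
  shows "int (rr_reduction_number R (monomial_ideal x y a b r)) \<le>
    \<lceil>max (2 * real (max_gen_length a r) + 2 - (real_of_int (frobenius_number a r) + 1) / real d)
         (2 * real (max_gen_length b r) + 2 - (real_of_int (frobenius_number b r) + 1) / real d)\<rceil> - 1"
    (is "_ \<le> \<lceil>max ?A ?B\<rceil> - 1")
proof -
  note pure = primary_imp_pure_powers[OF primary]
  have "0 < d" using pure(1,3) same_degree by (metis add_0 gr0I)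
  then interpret equigenerated_exponents a b r d
    using same_degree pure by unfold_locales auto
  \<comment> \<open>This makes the ceiling at least 2, so that \<open>nat\<close> in the definition
    of \<open>L\<close> does not truncate.\<close>
  have ge: "2 \<le> 2 * real \<Lambda> + 2 - (real_of_int g + 1) / real d"
    if "g + int d \<le> int (\<Lambda> * d)" for \<Lambda> g
  proof -
    have "real_of_int (g + int d) \<le> real_of_int (int (\<Lambda> * d))" using that by (simp only: of_int_le_iff)
    then have "real_of_int g + real d \<le> real \<Lambda> * real d" by simp
    moreover have "0 \<le> real \<Lambda> * real d" "1 \<le> real d" using degree_pos by auto
    ultimately have "real_of_int g + 1 \<le> 2 * real \<Lambda> * real d" by linarith
    then show ?thesis using degree_pos by (simp add: field_simps)
  qed
  define L where "L = nat (\<lceil>max ?A ?B\<rceil> - 1)"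
  have "2 \<le> max ?A ?B" using ge[OF A.max_gen_length_ge] by simp
  then have "2 \<le> \<lceil>max ?A ?B\<rceil>" by linarith
  then have L: "int L + 1 = \<lceil>max ?A ?B\<rceil>" by (simp add: L_def)
  \<comment> \<open>A real number is at most its ceiling, here \<open>L + 1\<close>; multiplication
    by \<open>d\<close> turns this into an inequality of integers.\<close>
  have integral: "2 * int \<Lambda> * int d + 2 * int d - (g + 1) \<le> (int L + 1) * int d"
    if "2 * real \<Lambda> + 2 - (real_of_int g + 1) / real d \<le> max ?A ?B" for \<Lambda> g
  proof -
    have "2 * real \<Lambda> + 2 - (real_of_int g + 1) / real d \<le> real_of_int (int L + 1)"
      unfolding L using that le_of_int_ceiling order.trans by blast
    then have "real_of_int (2 * int \<Lambda> * int d + 2 * int d - (g + 1)) \<le>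
        real_of_int ((int L + 1) * int d)"
      using degree_pos by (simp add: field_simps)
    then show ?thesis by linarith
  qed
  have "rr_reduction_number R (monomial_ideal x y a b r) \<le> L"
    using colon_exponent_stable[OF integral integral] by (intro rr_reduction_number_le) auto
  then show ?thesis using L by simp
qed

end

section \<open>The polynomial ring and the power series ring\<close>

interpretation bivariate_poly:
  bivariate_ring "\<lambda>f i j. Polynomial.coeff (Polynomial.coeff f j) i"
    "poly_x :: 'k::field poly poly" poly_y
proof
  fix f :: "'k poly poly" and u v i j :: nat
  \<comment> \<open>The factor \<open>x^u\<close> is constant in \<open>y\<close>, so it shifts
    inner coefficients while \<open>y^v\<close> shifts outer ones.\<close>
  have "poly_x ^ u * poly_y ^ v * f =
      [:Polynomial.monom 1 u:] * (Polynomial.monom 1 v * f)"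
    by (simp add: poly_x_def poly_y_def monom_altdef poly_const_pow mult_ac)
  then show "Polynomial.coeff (Polynomial.coeff (poly_x ^ u * poly_y ^ v * f) j) i =
      (if u \<le> i \<and> v \<le> j then Polynomial.coeff (Polynomial.coeff f (j - v)) (i - u) else 0)"
    by (simp add: Polynomial.coeff_monom_mult)
  have "Polynomial.coeff (Polynomial.coeff (map_poly (poly_shift u) (poly_shift v f)) j) i =
      Polynomial.coeff (Polynomial.coeff f (j + v)) (i + u)" for i j
    by (simp add: coeff_map_poly coeff_poly_shift)
  then show "\<exists>g. \<forall>i j. Polynomial.coeff (Polynomial.coeff g j) i =
      Polynomial.coeff (Polynomial.coeff f (j + v)) (i + u)"
    by blast
qed (auto simp: poly_eq_iff)

interpretation bivariate_fps:
  bivariate_ring "\<lambda>f i j. fps_nth (fps_nth f j) i" "fps_x :: 'k::field fps fps" fps_y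
proof
  fix f :: "'k fps fps" and u v i j :: nat
  have "fps_x ^ u * fps_y ^ v * f = fps_const (fps_X ^ u) * (fps_X ^ v * f)"
    by (simp add: fps_x_def fps_y_def mult_ac)
  then show "fps_nth (fps_nth (fps_x ^ u * fps_y ^ v * f) j) i =
      (if u \<le> i \<and> v \<le> j then fps_nth (fps_nth f (j - v)) (i - u) else 0)"
    by (simp only: fps_mult_left_const_nth fps_X_power_mult_nth) auto
  show "\<exists>g. \<forall>i j. fps_nth (fps_nth g j) i = fps_nth (fps_nth f (j + v)) (i + u)"
    \<comment> \<open>The outer series is reindexed by \<open>v\<close> and each of its coefficients
      is shifted by \<open>u\<close>.\<close>
    by (rule exI[of _ "Abs_fps (\<lambda>j. fps_shift u (fps_nth f (j + v)))"]) simp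
qed (auto simp: fps_eq_iff)

theorem proposition3p9:
  fixes a b :: "nat \<Rightarrow> nat" and r d :: nat
  assumes a_increasing: "\<And>i. i < r \<Longrightarrow> a i < a (Suc i)"
    and b_decreasing: "\<And>i. i < r \<Longrightarrow> b i > b (Suc i)"
    and same_degree: "\<And>i. i \<le> r \<Longrightarrow> a i + b i = d"
  shows
    "let bound = \<lceil>max
            (2 * real (max_gen_length a r) + 2 - (real_of_int (frobenius_number a r) + 1) / real d)
            (2 * real (max_gen_length b r) + 2 - (real_of_int (frobenius_number b r) + 1) / real d)\<rceil>
          - 1;
         P = (ring_of_type_algebra :: 'k::field poly poly ring);
         I = monomial_ideal (poly_x :: 'k poly poly) poly_y a b r;
         Q = (ring_of_type_algebra :: 'k fps fps ring);
         J = monomial_ideal (fps_x :: 'k fps fps) fps_y a b r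
     in (is_primary_to P (Idl\<^bsub>P\<^esub> {poly_x, poly_y}) I \<longrightarrow> int (rr_reduction_number P I) \<le> bound) \<and>
        (is_primary_to Q (Idl\<^bsub>Q\<^esub> {fps_x, fps_y}) J \<longrightarrow> int (rr_reduction_number Q J) \<le> bound)"
  unfolding Let_def
  using bivariate_poly.rr_reduction_number_bound[of r a b d, OF same_degree]
    bivariate_fps.rr_reduction_number_bound[of r a b d, OF same_degree]
  by blast

end
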